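(* Let $(\tilde U_E,\delta)$, $\delta=(\tau,\kappa)$, be a soft ditopological space. If for every soft point $x_A$ ($x\in U$, $A\subseteq E$) the soft set $x_A^c$ is open (i.e. $x_A^c\in\tau$) and the soft set $x_A$ is closed (i.e. $x_A\in\kappa$), then $(\tilde U_E,\delta)$ is a soft $T_1$-space.
   Context: Soft sets. Let $U$ be a universe set and $E$ a set of parameters. A soft set $F_A$ over $(U,E)$ is a map $F_A:A\to 2^U$ with $A\subseteq E$; values at $e\in E\setminus A$ are undefined. Its complement $F_A^c$ is the soft set on $A$ with $F_A^c(e)=U\setminus F_A(e)$. $F_A\tilde\subseteq G_B$ means $A\subseteq B$ and $F_A(e)\subseteq G_B(e)$ for all $e\in A$. The intersection of a family $F_{i}:A_i\to2^U$ is the soft set on $\bigcap_i A_i$ with value $\bigcap_i F_i(e)$; the union is the soft set on $\bigcup_iA_i$ whose value at $e$ is $\bigcup\{F_i(e): e\in A_i\}$. $\tilde U_A$ is the soft set on $A$ constantly equal to $U$; $\phi_A$ is the soft set on $A$ constantly $\emptyset$. For $x\in U$, $A\subseteq E$, the soft point $x_A$ is the soft set on $A$ with $x_A(e)=\{x\}$; $x_A\tilde\in F_B$ means $x\in F_B(e)$ for every $e\in A$ (in particular $A\subseteq B$), and $\tilde\notin$ is its negation. A soft topology $\tau$ on $\tilde U_E$ is a family of soft subsets of $\tilde U_E$ (open soft sets) with $\phi_A,\tilde U_E\in\tau$ for all $A\subseteq E$, closed under arbitrary unions and binary intersections. A soft cotopology $\kappa$ is a family of soft subsets of $\tilde U_E$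 (closed soft sets) with $\phi_A,\tilde U_E\in\kappa$ for all $A\subseteq E$, closed under arbitrary intersections and binary unions. A soft ditopological space is $(\tilde U_E,\delta)$ with $\delta=(\tau,\kappa)$, $\tau$ a soft topology and $\kappa$ a soft cotopology on $\tilde U_E$. $G_B$ is a $\tau$-neighborhood of $x_A$ if there is $H_C\in\tau$ with $x_A\tilde\in H_C\tilde\subseteq G_B$. $M_B$ is a soft remote neighborhood of $x_A$ if there is $K_C\in\kappa$ with $x_A\tilde\notin K_C$ and $M_B\tilde\subseteq K_C$. $(\tilde U_E,\tau)$ is a $\tau$-soft $T_1$-space if for any two different soft points $x_A\ne y_A$ ($x\neq y$ in $U$, $A\subseteq E$) there are $\tau$-neighborhoods $G_A,H_A$ (parameter set $A$) of $x_A,y_A$ respectively with $y_A\tilde\notin G_A$ and $x_A\tilde\notin H_A$. $(\tilde U_E,\kappa)$ is a $\kappa$-soft $T_1$-space if for any two different soft points $x_A\neq y_A$ there are a soft remote neighborhood $M_A$ of $x_A$ with $y_A\tilde\in M_A$ and a soft remote neighborhood $N_A$ of $y_A$ with $x_A\tilde\in N_A$. $(\tilde U_E,\delta)$ is a soft $T_1$-space if $(\tilde U_E,\tau)$ is $\tau$-soft $T_1$ and $(\tilde U_E,\kappa)$ is $\kappa$-soft $T_1$. *)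

theory Defs
  imports Main
begin

text \<open>
  A soft set \<open>F\<^sub>A\<close> is a partial map with domain exactly \<open>A\<close>, so a parameter outside \<open>A\<close>
  (value undefined) is distinguished from one at which the value is empty.  The universe \<open>U\<close>
  and the parameter set \<open>E\<close> are arbitrary carrier sets.
\<close>

type_synonym ('e, 'u) soft_set = "'e \<rightharpoonup> 'u set"

definition soft_set_over :: "'u set \<Rightarrow> 'e set \<Rightarrow> ('e, 'u) soft_set \<Rightarrow> bool" where
  "soft_set_over U E F \<longleftrightarrow> dom F \<subseteq> E \<and> (\<forall>e\<in>dom F. the (F e) \<subseteq> U)"

definition soft_const :: "'e set \<Rightarrow> 'u set \<Rightarrow> ('e, 'u) soft_set" where
  "soft_const A X = (\<lambda>e. if e \<in> A then Some X else None)"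

definition soft_whole :: "'u set \<Rightarrow> 'e set \<Rightarrow> ('e, 'u) soft_set" where
  "soft_whole U A = soft_const A U"

definition soft_null :: "'e set \<Rightarrow> ('e, 'u) soft_set" where
  "soft_null A = soft_const A {}"

definition soft_point :: "'u \<Rightarrow> 'e set \<Rightarrow> ('e, 'u) soft_set" where
  "soft_point x A = soft_const A {x}"

text \<open>The complement keeps the domain and complements each value relative to \<open>U\<close>.\<close>

definition soft_compl :: "'u set \<Rightarrow> ('e, 'u) soft_set \<Rightarrow> ('e, 'u) soft_set" where
  "soft_compl U F = (\<lambda>e. map_option (\<lambda>X. U - X) (F e))"

definition soft_subset :: "('e, 'u) soft_set \<Rightarrow> ('e, 'u) soft_set \<Rightarrow> bool" where
  "soft_subset F G \<longleftrightarrow> dom F \<subseteq> dom G \<and> (\<forall>e\<in>dom F. the (F e) \<subseteq> the (G e))"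

text \<open>Only meaningful for a nonempty family.\<close>

definition soft_Inter :: "('e, 'u) soft_set set \<Rightarrow> ('e, 'u) soft_set" where
  "soft_Inter \<F> =
     (\<lambda>e. if e \<in> (\<Inter>F\<in>\<F>. dom F) then Some (\<Inter>F\<in>\<F>. the (F e)) else None)"

definition soft_Union :: "('e, 'u) soft_set set \<Rightarrow> ('e, 'u) soft_set" where
  "soft_Union \<F> =
     (\<lambda>e. if e \<in> (\<Union>F\<in>\<F>. dom F) then Some (\<Union>F\<in>{F \<in> \<F>. e \<in> dom F}. the (F e)) else None)"

text \<open>\<open>soft_mem x A F\<close> says that the soft point \<open>x\<^sub>A\<close> belongs to the soft set \<open>F\<close>.\<close>

definition soft_mem :: "'u \<Rightarrow> 'e set \<Rightarrow> ('e, 'u) soft_set \<Rightarrow> bool" where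
  "soft_mem x A F \<longleftrightarrow> A \<subseteq> dom F \<and> (\<forall>e\<in>A. x \<in> the (F e))"

definition soft_topology :: "'u set \<Rightarrow> 'e set \<Rightarrow> ('e, 'u) soft_set set \<Rightarrow> bool" where
  "soft_topology U E \<tau> \<longleftrightarrow>
     (\<forall>F\<in>\<tau>. soft_set_over U E F) \<and>
     (\<forall>A. A \<subseteq> E \<longrightarrow> soft_null A \<in> \<tau>) \<and>
     soft_whole U E \<in> \<tau> \<and>
     (\<forall>\<F>. \<F> \<subseteq> \<tau> \<longrightarrow> soft_Union \<F> \<in> \<tau>) \<and>
     (\<forall>F\<in>\<tau>. \<forall>G\<in>\<tau>. soft_Inter {F, G} \<in> \<tau>)"

text \<open>
  Intersections are taken over nonempty families; the empty intersection, read inside the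
  whole soft set, would be the whole soft set, which is required to be a member anyway.
\<close>

definition soft_cotopology :: "'u set \<Rightarrow> 'e set \<Rightarrow> ('e, 'u) soft_set set \<Rightarrow> bool" where
  "soft_cotopology U E \<kappa> \<longleftrightarrow>
     (\<forall>F\<in>\<kappa>. soft_set_over U E F) \<and>
     (\<forall>A. A \<subseteq> E \<longrightarrow> soft_null A \<in> \<kappa>) \<and>
     soft_whole U E \<in> \<kappa> \<and>
     (\<forall>\<F>. \<F> \<noteq> {} \<and> \<F> \<subseteq> \<kappa> \<longrightarrow> soft_Inter \<F> \<in> \<kappa>) \<and>
     (\<forall>F\<in>\<kappa>. \<forall>G\<in>\<kappa>. soft_Union {F, G} \<in> \<kappa>)"

definition soft_ditopological_space ::
    "'u set \<Rightarrow> 'e set \<Rightarrow> ('e, 'u) soft_set set \<Rightarrow> ('e, 'u) soft_set set \<Rightarrow> bool" where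
  "soft_ditopological_space U E \<tau> \<kappa> \<longleftrightarrow> soft_topology U E \<tau> \<and> soft_cotopology U E \<kappa>"

definition soft_nbhd ::
    "'u set \<Rightarrow> 'e set \<Rightarrow> ('e, 'u) soft_set set \<Rightarrow> 'u \<Rightarrow> 'e set \<Rightarrow> ('e, 'u) soft_set \<Rightarrow> bool" where
  "soft_nbhd U E \<tau> x A G \<longleftrightarrow>
     soft_set_over U E G \<and> (\<exists>H\<in>\<tau>. soft_mem x A H \<and> soft_subset H G)"

definition soft_remote_nbhd ::
    "'u set \<Rightarrow> 'e set \<Rightarrow> ('e, 'u) soft_set set \<Rightarrow> 'u \<Rightarrow> 'e set \<Rightarrow> ('e, 'u) soft_set \<Rightarrow> bool" where
  "soft_remote_nbhd U E \<kappa> x A M \<longleftrightarrow>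
     soft_set_over U E M \<and> (\<exists>K\<in>\<kappa>. \<not> soft_mem x A K \<and> soft_subset M K)"

text \<open>
  Different soft points are soft points that differ as soft sets.  Over the empty parameter
  set all soft points coincide with the empty map (and belong to every soft set), so there are
  no two different ones; over a nonempty parameter set this is the same as \<open>x \<noteq> y\<close>.
\<close>

lemma soft_point_neq_iff: "soft_point x A \<noteq> soft_point y A \<longleftrightarrow> x \<noteq> y \<and> A \<noteq> {}"
  by (auto simp: soft_point_def soft_const_def fun_eq_iff)

definition tau_soft_T1 :: "'u set \<Rightarrow> 'e set \<Rightarrow> ('e, 'u) soft_set set \<Rightarrow> bool" where
  "tau_soft_T1 U E \<tau> \<longleftrightarrow>
     (\<forall>A x y. A \<subseteq> E \<and> x \<in> U \<and> y \<in> U \<and> soft_point x A \<noteq> soft_point y A \<longrightarrow>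
       (\<exists>G H. dom G = A \<and> dom H = A \<and>
          soft_nbhd U E \<tau> x A G \<and> soft_nbhd U E \<tau> y A H \<and>
          \<not> soft_mem y A G \<and> \<not> soft_mem x A H))"

definition kappa_soft_T1 :: "'u set \<Rightarrow> 'e set \<Rightarrow> ('e, 'u) soft_set set \<Rightarrow> bool" where
  "kappa_soft_T1 U E \<kappa> \<longleftrightarrow>
     (\<forall>A x y. A \<subseteq> E \<and> x \<in> U \<and> y \<in> U \<and> soft_point x A \<noteq> soft_point y A \<longrightarrow>
       (\<exists>M N. dom M = A \<and> dom N = A \<and>
          soft_remote_nbhd U E \<kappa> x A M \<and> soft_mem y A M \<and>
          soft_remote_nbhd U E \<kappa> y A N \<and> soft_mem x A N))"

definition soft_T1_space ::
    "'u set \<Rightarrow> 'e set \<Rightarrow> ('e, 'u) soft_set set \<Rightarrow> ('e, 'u) soft_set set \<Rightarrow> bool" where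
  "soft_T1_space U E \<tau> \<kappa> \<longleftrightarrow> tau_soft_T1 U E \<tau> \<and> kappa_soft_T1 U E \<kappa>"

end

theory Submission
  imports Defs
begin

text \<open>The separating soft sets can be written down directly. For distinct soft points over A,
  we have x \<noteq> y and A nonempty. The complement of \<open>soft_point y A\<close> has the value
  U - {y} at each parameter of A, so it contains the soft point of x and misses that of y. Being
  open, it is its own neighborhood. Dually, \<open>soft_point y A\<close> is closed, contains the
  soft point of y and misses that of x, so it is its own remote neighborhood of the latter.
  Exchanging x and y gives the other half of each condition, and all these soft sets have domain
  exactly A. The two halves are \<open>tau_soft_T1_if_compl_points_open\<close> and
  \<open>kappa_soft_T1_if_points_closed\<close>.\<close>

lemma dom_soft_const [simp]: "dom (soft_const A X) = A"
  by (simp add: soft_const_def dom_def)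

lemma dom_soft_point [simp]: "dom (soft_point x A) = A"
  by (simp add: soft_point_def)

lemma dom_soft_compl [simp]: "dom (soft_compl U F) = dom F"
  by (simp add: soft_compl_def dom_def)

text \<open>The disjunct \<open>A = {}\<close> is there because membership quantifies over the
  parameters in A and is vacuous when there are none; the same holds for the complement
  below.\<close>

lemma soft_mem_point_iff: "soft_mem y A (soft_point x A) \<longleftrightarrow> y = x \<or> A = {}"
proof -
  have "the (soft_point x A e) = {x}" if "e \<in> A" for e
    using that by (simp add: soft_point_def soft_const_def)
  then show ?thesis
    by (auto simp: soft_mem_def)
qed

lemma soft_mem_compl_point_iff:
  "soft_mem y A (soft_compl U (soft_point x A)) \<longleftrightarrow> y \<in> U \<and> y \<noteq> x \<or> A = {}"
proof -
  have "the (soft_compl U (soft_point x A) e) = U - {x}" if "e \<in> A" for e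
    using that by (simp add: soft_compl_def soft_point_def soft_const_def)
  then show ?thesis
    by (auto simp: soft_mem_def)
qed

lemma soft_subset_refl: "soft_subset F F"
  by (simp add: soft_subset_def)

text \<open>G itself serves as the intermediate open soft set; that it lies over U and E comes from
  the first clause of the topology.\<close>

lemma soft_nbhd_of_open:
  assumes "soft_topology U E \<tau>" "G \<in> \<tau>" "soft_mem x A G"
  shows "soft_nbhd U E \<tau> x A G"
proof -
  have "\<forall>F\<in>\<tau>. soft_set_over U E F"
    using assms(1) unfolding soft_topology_def by (rule conjunct1)
  then have "soft_set_over U E G"
    using assms(2) by (rule bspec)
  then show ?thesis
    using assms(2,3) soft_subset_refl[of G] unfolding soft_nbhd_def by blast
qed

text \<open>The dual argument: M itself serves as the closed soft set that avoids the soft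
  point.\<close>

lemma soft_remote_nbhd_of_closed:
  assumes "soft_cotopology U E \<kappa>" "M \<in> \<kappa>" "\<not> soft_mem x A M"
  shows "soft_remote_nbhd U E \<kappa> x A M"
proof -
  have "\<forall>F\<in>\<kappa>. soft_set_over U E F"
    using assms(1) unfolding soft_cotopology_def by (rule conjunct1)
  then have "soft_set_over U E M"
    using assms(2) by (rule bspec)
  then show ?thesis
    using assms(2,3) soft_subset_refl[of M] unfolding soft_remote_nbhd_def by blast
qed

lemma tau_soft_T1_if_compl_points_open:
  assumes "soft_topology U E \<tau>"
    and "\<And>x A. x \<in> U \<Longrightarrow> A \<subseteq> E \<Longrightarrow> soft_compl U (soft_point x A) \<in> \<tau>"
  shows "tau_soft_T1 U E \<tau>"
  unfolding tau_soft_T1_def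
proof (intro allI impI, elim conjE)
  fix A x y
  assume "A \<subseteq> E" "x \<in> U" "y \<in> U" and "soft_point x A \<noteq> soft_point y A"
  then have "x \<noteq> y" "A \<noteq> {}"
    by (auto simp: soft_point_neq_iff)
  with \<open>A \<subseteq> E\<close> \<open>x \<in> U\<close> \<open>y \<in> U\<close> show "\<exists>G H. dom G = A \<and> dom H = A \<and>
      soft_nbhd U E \<tau> x A G \<and> soft_nbhd U E \<tau> y A H \<and>
      \<not> soft_mem y A G \<and> \<not> soft_mem x A H"
    \<comment> \<open>The neighborhood of each soft point is the complement of the other one, hence
      the crossed order of x and y.\<close>
    by (intro exI[of _ "soft_compl U (soft_point y A)"] exI[of _ "soft_compl U (soft_point x A)"])
      (simp add: soft_mem_compl_point_iff soft_nbhd_of_open assms)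
qed

lemma kappa_soft_T1_if_points_closed:
  assumes "soft_cotopology U E \<kappa>"
    and "\<And>x A. x \<in> U \<Longrightarrow> A \<subseteq> E \<Longrightarrow> soft_point x A \<in> \<kappa>"
  shows "kappa_soft_T1 U E \<kappa>"
  unfolding kappa_soft_T1_def
proof (intro allI impI, elim conjE)
  fix A x y
  assume "A \<subseteq> E" "x \<in> U" "y \<in> U" and "soft_point x A \<noteq> soft_point y A"
  then have "x \<noteq> y" "A \<noteq> {}"
    by (auto simp: soft_point_neq_iff)
  with \<open>A \<subseteq> E\<close> \<open>x \<in> U\<close> \<open>y \<in> U\<close> show "\<exists>M N. dom M = A \<and> dom N = A \<and>
      soft_remote_nbhd U E \<kappa> x A M \<and> soft_mem y A M \<and>
      soft_remote_nbhd U E \<kappa> y A N \<and> soft_mem x A N"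
    \<comment> \<open>Crossed again: a remote neighborhood of one soft point that contains the other
      is simply that other soft point.\<close>
    by (intro exI[of _ "soft_point y A"] exI[of _ "soft_point x A"])
      (simp add: soft_mem_point_iff soft_remote_nbhd_of_closed assms)
qed

theorem theorem5p8:
  fixes U :: "'u set" and E :: "'e set"
    and \<tau> \<kappa> :: "('e, 'u) soft_set set"
  assumes "soft_ditopological_space U E \<tau> \<kappa>"
    and "\<And>x A. x \<in> U \<Longrightarrow> A \<subseteq> E \<Longrightarrow> soft_compl U (soft_point x A) \<in> \<tau>"
    and "\<And>x A. x \<in> U \<Longrightarrow> A \<subseteq> E \<Longrightarrow> soft_point x A \<in> \<kappa>"
  shows "soft_T1_space U E \<tau> \<kappa>"
proof -
  have "soft_topology U E \<tau>" "soft_cotopology U E \<kappa>"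
    using assms(1) by (simp_all add: soft_ditopological_space_def)
  then show ?thesis
    unfolding soft_T1_space_def
    using tau_soft_T1_if_compl_points_open[OF _ assms(2)] kappa_soft_T1_if_points_closed[OF _ assms(3)]
    by simp
qed

end
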